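(* Let $F$ and $G$ be real normed spaces and let $S:F\to G$ be a continuous (not necessarily linear) operator. Then for $n=0$ and all $n\in\mathbb{N}=\{1,2,\dots\}$, $$e_n^{\rm all\text{-}wor}(S)=\widetilde e_n^{\rm \,all\text{-}wor}(S).$$
   Context: Let $\Lambda^{\rm all}$ be the class of all continuous linear functionals $F\to\mathbb{R}$ and $\widetilde\Lambda^{\rm all}$ the class of all linear functionals $F\to\mathbb{R}$, continuous or not. For $\Lambda\in\{\Lambda^{\rm all},\widetilde\Lambda^{\rm all}\}$ and an integer $n\ge 0$, an algorithm $A_n:F\to G$ using $n$ functionals from $\Lambda$ is a mapping of the form $$A_n(f)=\phi_n\big(y_1,y_2,\dots,y_n\big),\qquad y_j=L_j(f;y_1,\dots,y_{j-1}),$$ where $\phi_n:\mathbb{R}^n\to G$ is an arbitrary mapping and, for each $j$ and all $y_1,\dots,y_{j-1}\in\mathbb{R}$, $L_j(\cdot\,;y_1,\dots,y_{j-1})\in\Lambda$. Thus the functionals may be chosen adaptively, i.e. $L_j$ may depend on the already computed values (the nonadaptive case, where $L_j$ does not depend on them, is included). For $n=0$, $A_0$ is a constant element of $G$. The worst case error of $A_n$ is $$e(A_n)=\sup_{\|f\|_F<1}\|S(f)-A_n(f)\|_G\in[0,\infty].$$ The $n$th minimal worst case errors are $$e_n^{\rm all\text{-}wor}(S)=\inf\{e(A_n): A_n \text{ uses } n \text{ functionals from }\Lambda^{\rm all}\},$$ $$\widetilde e_n^{\rm \,all\text{-}wor}(S)=\inf\{e(A_n): A_n \text{ uses } n \text{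 functionals from }\widetilde\Lambda^{\rm all}\}.$$ *)

theory Defs
  imports "HOL-Analysis.Analysis"
begin

definition Lambda_all :: "('a::real_normed_vector \<Rightarrow> real) set" where
  "Lambda_all = {L. linear L \<and> continuous_on UNIV L}"

definition Lambda_all_tilde :: "('a::real_normed_vector \<Rightarrow> real) set" where
  "Lambda_all_tilde = {L. linear L}"

text \<open>
  An adaptive choice of functionals is a map \<open>L\<close> from the list of the values computed so far:
  \<open>L [y\<^sub>1, \<dots>, y\<^sub>j\<^sub>-\<^sub>1]\<close> is the functional \<open>L\<^sub>j(\<sqdot>; y\<^sub>1, \<dots>, y\<^sub>j\<^sub>-\<^sub>1)\<close>, so the index \<open>j\<close> is one more than the
  length of the list. The list \<open>info L n f\<close> is \<open>[y\<^sub>1, \<dots>, y\<^sub>n]\<close>.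
\<close>

primrec info :: "(real list \<Rightarrow> 'a \<Rightarrow> real) \<Rightarrow> nat \<Rightarrow> 'a \<Rightarrow> real list" where
  "info L 0 f = []"
| "info L (Suc n) f = info L n f @ [L (info L n f) f]"

text \<open>
  The set \<open>\<real>\<^sup>n\<close> is represented by the real lists of length \<open>n\<close>. The values of \<open>L\<close> on lists of
  length at least \<open>n\<close>, and of \<open>\<phi>\<close> on lists of length other than \<open>n\<close>, are irrelevant.
\<close>

definition algorithms :: "('a \<Rightarrow> real) set \<Rightarrow> nat \<Rightarrow> ('a \<Rightarrow> 'b) set" where
  "algorithms \<Lambda> n =
     {A. \<exists>(L :: real list \<Rightarrow> 'a \<Rightarrow> real) (\<phi> :: real list \<Rightarrow> 'b).
           (\<forall>ys. length ys < n \<longrightarrow> L ys \<in> \<Lambda>) \<and> (\<forall>f. A f = \<phi> (info L n f))}"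

definition wor_error ::
  "('a::real_normed_vector \<Rightarrow> 'b::real_normed_vector) \<Rightarrow> ('a \<Rightarrow> 'b) \<Rightarrow> ennreal" where
  "wor_error S A = (SUP f\<in>{f. norm f < 1}. ennreal (norm (S f - A f)))"

definition minimal_wor_error ::
  "('a \<Rightarrow> real) set \<Rightarrow> nat \<Rightarrow> ('a::real_normed_vector \<Rightarrow> 'b::real_normed_vector) \<Rightarrow> ennreal" where
  "minimal_wor_error \<Lambda> n S = (INF A\<in>algorithms \<Lambda> n. wor_error S A)"

definition e_all_wor ::
  "nat \<Rightarrow> ('a::real_normed_vector \<Rightarrow> 'b::real_normed_vector) \<Rightarrow> ennreal" where
  "e_all_wor n S = minimal_wor_error Lambda_all n S"

definition e_all_wor_tilde ::
  "nat \<Rightarrow> ('a::real_normed_vector \<Rightarrow> 'b::real_normed_vector) \<Rightarrow> ennreal" where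
  "e_all_wor_tilde n S = minimal_wor_error Lambda_all_tilde n S"

end

(* Run a given algorithm with arbitrary linear functionals, and let K be the common kernel of the
   functionals used so far. If the next functional is bounded on K, then it agrees on K with a
   continuous functional M on the whole space, so on the current level set it differs from M by a
   constant and can be replaced by M. If it is unbounded on K, then each of its level sets is dense
   in the current level set, so nothing needs to be measured and its value is set to 0. In this way
   every f is in the closure of the level set of the simulated values, and continuity of S
   carries the error bound over to f, the unit ball being open. *)
theory Submission
  imports Defs
begin

section \<open>Functionals bounded on a common kernel\<close>

lemma unbounded_imp_small_with_value_1:
  fixes T :: "'a::real_normed_vector \<Rightarrow> real"
  assumes K: "subspace K" and T: "linear T"
    and unb: "\<nexists>B. \<forall>x\<in>K. \<bar>T x\<bar> \<le> B * norm x" and e: "e > 0"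
  shows "\<exists>u\<in>K. T u = 1 \<and> norm u < e"
proof -
  \<comment> \<open>A vector violating the bound with constant \<open>1 / e\<close>, divided by its
    value under \<open>T\<close>, has norm below \<open>e\<close>.\<close>
  obtain x where x: "x \<in> K" "\<bar>T x\<bar> > (1 / e) * norm x" using unb by (meson not_le)
  have "0 \<le> (1 / e) * norm x" using e by simp
  then have nz: "\<bar>T x\<bar> > 0" using x by linarith
  have "norm ((1 / T x) *\<^sub>R x) < e" using x nz e by (simp add: field_simps)
  then show ?thesis
    using K x nz by (intro bexI[of _ "(1 / T x) *\<^sub>R x"]) (auto simp: linear_scale[OF T] subspace_scale)
qed

text \<open>This removes one kernel constraint at the cost of adding a multiple of \<open>T\<close>.
  If \<open>T\<close> is bounded on \<open>K\<close>, vectors are projected into its kernel along a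
  fixed \<open>v\<close>. Otherwise that kernel is dense in \<open>K\<close>, and the bound passes
  to the limit.\<close>

lemma bounded_on_kernel_imp_bounded_combination:
  fixes T L :: "'a::real_normed_vector \<Rightarrow> real"
  assumes K: "subspace K" and T: "linear T" and L: "linear L"
    and C: "\<And>x. x \<in> K \<Longrightarrow> T x = 0 \<Longrightarrow> \<bar>L x\<bar> \<le> C * norm x"
  shows "\<exists>c D. \<forall>x\<in>K. \<bar>L x + c * T x\<bar> \<le> D * norm x"
proof (cases "\<exists>B. \<forall>x\<in>K. \<bar>T x\<bar> \<le> B * norm x")
  case True
  then obtain B where B: "\<And>x. x \<in> K \<Longrightarrow> \<bar>T x\<bar> \<le> B * norm x" by blast
  show ?thesis
  proof (cases "\<exists>v\<in>K. T v \<noteq> 0")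
    case False
    then show ?thesis using C by (intro exI[of _ 0] exI[of _ C]) auto
  next
    case True
    then obtain v where v: "v \<in> K" "T v \<noteq> 0" by blast
    \<comment> \<open>With this \<open>c\<close>, \<open>L + c * T\<close> vanishes at
      \<open>v\<close>, so its value at \<open>x\<close> is that of \<open>L\<close> at the
      projection \<open>y\<close> below, where the bound \<open>C\<close> applies.\<close>
    define c where "c = - (L v / T v)"
    have "\<bar>L x + c * T x\<bar> \<le> (\<bar>C\<bar> * (1 + B * norm v / \<bar>T v\<bar>)) * norm x" if x: "x \<in> K" for x
    proof -
      define y where "y = x - (T x / T v) *\<^sub>R v"
      have yK: "y \<in> K" unfolding y_def using K x v by (intro subspace_diff subspace_scale)
      have Ty: "T y = 0" unfolding y_def using v by (simp add: linear_diff[OF T] linear_scale[OF T])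
      have Ly: "L y = L x + c * T x"
        unfolding y_def c_def by (simp add: linear_diff[OF L] linear_scale[OF L])
      have "norm y \<le> norm x + \<bar>T x\<bar> / \<bar>T v\<bar> * norm v"
        unfolding y_def by (rule order_trans[OF norm_triangle_ineq4]) simp
      also have "\<dots> \<le> norm x + B * norm x / \<bar>T v\<bar> * norm v"
        using B[OF x] by (intro add_left_mono mult_right_mono divide_right_mono) auto
      finally have ny: "norm y \<le> (1 + B * norm v / \<bar>T v\<bar>) * norm x" by (simp add: algebra_simps)
      have "\<bar>L y\<bar> \<le> \<bar>C\<bar> * norm y"
        using C[OF yK Ty] by (rule order_trans) (simp add: mult_right_mono)
      also have "\<dots> \<le> \<bar>C\<bar> * ((1 + B * norm v / \<bar>T v\<bar>) * norm x)"
        using ny by (intro mult_left_mono) auto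
      finally show ?thesis by (simp add: Ly algebra_simps)
    qed
    then show ?thesis by blast
  qed
next
  case False
  have "\<exists>u\<in>K. T u = 1 \<and> norm u < e" if "e > 0" for e :: real
    using unbounded_imp_small_with_value_1[OF K T False that] .
  then have "\<exists>u. \<forall>n::nat. u n \<in> K \<and> T (u n) = 1 \<and> norm (u n) < inverse (real (Suc n))"
    by (intro choice) (metis inverse_positive_iff_positive of_nat_0_less_iff zero_less_Suc)
  then obtain u where u: "\<And>n. u n \<in> K" "\<And>n. T (u n) = 1"
      "\<And>n::nat. norm (u n) < inverse (real (Suc n))" by blast
  have u0: "u \<longlonglongrightarrow> 0"
    by (rule Lim_null_comparison[OF _ LIMSEQ_inverse_real_of_nat])
       (intro always_eventually allI less_imp_le u(3))
  \<comment> \<open>The differences \<open>u m - u n\<close> lie in the kernel of \<open>T\<close>,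
    where \<open>L\<close> is bounded, although \<open>L\<close> may be unbounded along
    \<open>u\<close>.\<close>
  have "Cauchy (\<lambda>n. L (u n))"
  proof (rule metric_CauchyI)
    fix e :: real assume e: "e > 0"
    have "Cauchy u" using u0 by (rule LIMSEQ_imp_Cauchy)
    then obtain N where N: "\<And>m n. m \<ge> N \<Longrightarrow> n \<ge> N \<Longrightarrow> norm (u m - u n) < e / (\<bar>C\<bar> + 1)"
      using e by (auto simp: Cauchy_def dist_norm dest!: spec[of _ "e / (\<bar>C\<bar> + 1)"])
    show "\<exists>N. \<forall>m\<ge>N. \<forall>n\<ge>N. dist (L (u m)) (L (u n)) < e"
    proof (intro exI allI impI)
      fix m n assume mn: "m \<ge> N" "n \<ge> N"
      have "dist (L (u m)) (L (u n)) = \<bar>L (u m - u n)\<bar>" by (simp add: dist_real_def linear_diff[OF L])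
      also have "\<dots> \<le> C * norm (u m - u n)"
        using u K by (intro C) (auto simp: linear_diff[OF T] subspace_diff)
      also have "\<dots> \<le> (\<bar>C\<bar> + 1) * norm (u m - u n)" by (intro mult_right_mono) auto
      also have "\<dots> < (\<bar>C\<bar> + 1) * (e / (\<bar>C\<bar> + 1))"
        using N[OF mn] by (intro mult_strict_left_mono) auto
      finally show "dist (L (u m)) (L (u n)) < e" by simp
    qed
  qed
  then obtain l where l: "(\<lambda>n. L (u n)) \<longlonglongrightarrow> l" using Cauchy_convergent convergent_def by blast
  \<comment> \<open>The vectors \<open>x - T x *\<^sub>R u n\<close> lie in the kernel of
    \<open>T\<close> and tend to \<open>x\<close>, while their values under \<open>L\<close> tend to
    \<open>L x - l * T x\<close>.\<close>
  have "\<bar>L x + (- l) * T x\<bar> \<le> C * norm x" if x: "x \<in> K" for x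
  proof (rule LIMSEQ_le)
    show "(\<lambda>n. \<bar>L x - T x * L (u n)\<bar>) \<longlonglongrightarrow> \<bar>L x + (- l) * T x\<bar>"
      using l by (auto intro!: tendsto_eq_intros simp: mult.commute)
    show "(\<lambda>n. C * norm (x - T x *\<^sub>R u n)) \<longlonglongrightarrow> C * norm x"
      using u0 by (auto intro!: tendsto_eq_intros)
    have "\<bar>L x - T x * L (u n)\<bar> \<le> C * norm (x - T x *\<^sub>R u n)" for n
      using C[of "x - T x *\<^sub>R u n"] u K x
      by (simp add: linear_diff[OF T] linear_scale[OF T] linear_diff[OF L] linear_scale[OF L]
          subspace_diff subspace_scale)
    then show "\<exists>N. \<forall>n\<ge>N. \<bar>L x - T x * L (u n)\<bar> \<le> C * norm (x - T x *\<^sub>R u n)" by blast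
  qed
  then show ?thesis by blast
qed

lemma subspace_common_kernel:
  fixes F :: "('a::real_normed_vector \<Rightarrow> real) set"
  assumes "\<And>T. T \<in> F \<Longrightarrow> linear T"
  shows "subspace {x. \<forall>T\<in>F. T x = 0}"
  using assms by (auto simp: subspace_def linear_0 linear_add linear_scale)

text \<open>Induction removes the constraints one at a time: \<open>L\<close> is replaced by
  \<open>L + c * T\<close>, which agrees with \<open>L\<close> where \<open>T\<close> vanishes.
  Since \<open>F\<close> is finite, this ends with a functional bounded on the whole space, without
  Hahn-Banach.\<close>

lemma bounded_on_common_kernel_extends:
  fixes F :: "('a::real_normed_vector \<Rightarrow> real) set"
  assumes "finite F" "\<And>T. T \<in> F \<Longrightarrow> linear T" "linear L"
    and "\<And>x. \<forall>T\<in>F. T x = 0 \<Longrightarrow> \<bar>L x\<bar> \<le> C * norm x"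
  shows "\<exists>M. bounded_linear M \<and> (\<forall>x. (\<forall>T\<in>F. T x = 0) \<longrightarrow> M x = L x)"
  using assms
proof (induction F arbitrary: L C rule: finite_induct)
  case empty
  then have "bounded_linear L"
    by (intro bounded_linear_intro[of L C]) (auto simp: linear_add linear_scale mult.commute)
  then show ?case by blast
next
  case (insert T F)
  let ?K = "{x. \<forall>T\<in>F. T x = 0}"
  have T: "linear T" using insert.prems by blast
  have "subspace ?K" using insert.prems by (intro subspace_common_kernel) blast
  from bounded_on_kernel_imp_bounded_combination[OF this T insert.prems(2), of C]
  obtain c D where cD: "\<forall>x\<in>?K. \<bar>L x + c * T x\<bar> \<le> D * norm x"
    using insert.prems(3) by auto
  have "linear (\<lambda>x. L x + c * T x)"
    using T insert.prems(2)
    by (intro linearI) (auto simp: linear_add linear_scale algebra_simps)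
  then obtain M where "bounded_linear M" "\<forall>x. (\<forall>T\<in>F. T x = 0) \<longrightarrow> M x = L x + c * T x"
    using insert.IH[of "\<lambda>x. L x + c * T x" D] insert.prems(1) cD by auto
  then show ?case by auto
qed

section \<open>Simulating a single functional\<close>

text \<open>Here \<open>P\<close> is empty or a translate of the common kernel, and \<open>h\<close>
  turns the measured value of \<open>M\<close> into a simulated value of \<open>L\<close>. Points of
  the closure are treated because earlier simulated steps place \<open>f\<close> only there.\<close>

lemma simulate_functional_on_level_set:
  fixes F :: "('a::real_normed_vector \<Rightarrow> real) set" and L :: "'a \<Rightarrow> real" and P :: "'a set"
  assumes F: "finite F" "\<And>T. T \<in> F \<Longrightarrow> linear T" and L: "linear L"
    and P: "\<And>p q. p \<in> P \<Longrightarrow> q \<in> P \<longleftrightarrow> (\<forall>T\<in>F. T (q - p) = 0)"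
  shows "\<exists>(M :: 'a \<Rightarrow> real) h. bounded_linear M \<and> (\<forall>f\<in>closure P. f \<in> closure {g\<in>P. L g = h (M f)})"
proof -
  let ?K = "{x. \<forall>T\<in>F. T x = 0}"
  have K: "subspace ?K" using F by (intro subspace_common_kernel)
  have shift: "g + a *\<^sub>R v \<in> P" if "g \<in> P" "v \<in> ?K" for g a v
    using P[OF that(1), of "g + a *\<^sub>R v"] that(2) F by (auto simp: linear_scale)
  show ?thesis
  proof (cases "\<exists>C. \<forall>x\<in>?K. \<bar>L x\<bar> \<le> C * norm x")
    case True
    then obtain C where "\<forall>x\<in>?K. \<bar>L x\<bar> \<le> C * norm x" by blast
    then obtain M where M: "bounded_linear M" and M_eq: "\<And>x. x \<in> ?K \<Longrightarrow> M x = L x"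
      using bounded_on_common_kernel_extends[OF F L, of C] by auto
    have lM: "linear M" using M by (rule bounded_linear.linear)
    show ?thesis
    proof (cases "P = {}")
      case True
      then show ?thesis using M by auto
    next
      case False
      then obtain p where p: "p \<in> P" by blast
      define h where "h z = z + (L p - M p)" for z
      have Lh: "L g = h (M g)" if "g \<in> P" for g
        using M_eq[of "g - p"] P[OF p, of g] that
        by (simp add: h_def linear_diff[OF L] linear_diff[OF lM])
      have contM: "continuous_on UNIV M" using M by (simp add: linear_continuous_on)
      have "f \<in> closure {g\<in>P. L g = h (M f)}" if f: "f \<in> closure P" for f
      proof -
        \<comment> \<open>Moving along \<open>v\<close> stays in \<open>P\<close> and corrects the
          value of \<open>M\<close> to \<open>M f\<close>. If \<open>M\<close> vanishes on the
          kernel, it is constant on \<open>P\<close> and, by continuity, on its closure, so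
          \<open>v = 0\<close> serves.\<close>
        obtain v where v: "v \<in> ?K" "\<And>g. g \<in> P \<Longrightarrow> M (g + (M f - M g) *\<^sub>R v) = M f"
        proof (cases "\<exists>x\<in>?K. M x \<noteq> 0")
          case True
          then obtain x where x: "x \<in> ?K" "M x \<noteq> 0" by blast
          show ?thesis
          proof
            show "(1 / M x) *\<^sub>R x \<in> ?K" using K x(1) by (rule subspace_scale)
          qed (use x(2) in \<open>simp add: linear_add[OF lM] linear_scale[OF lM]\<close>)
        next
          case False
          have "M g = M p" if "g \<in> P" for g
          proof -
            have "M (g - p) = 0" using False P[OF p, of g] that by auto
            then show ?thesis by (simp add: linear_diff[OF lM])
          qed
          then have "P \<subseteq> {g. M g = M p}" by blast
          moreover have "closed {g. M g = M p}"
            by (intro closed_Collect_eq contM continuous_intros)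
          ultimately have Mf: "M f = M p" using closure_minimal f by blast
          show ?thesis
          proof
            show "0 \<in> ?K" using K by (rule subspace_0)
          qed (use Mf \<open>\<And>g. g \<in> P \<Longrightarrow> M g = M p\<close> in simp)
        qed
        \<comment> \<open>This continuous map fixes \<open>f\<close> and sends \<open>P\<close> into
          the required level set, so it carries an approximation of \<open>f\<close> from
          \<open>P\<close> to one from that level set.\<close>
        define \<psi> where "\<psi> g = g + (M f - M g) *\<^sub>R v" for g
        have "continuous_on UNIV \<psi>"
          unfolding \<psi>_def by (intro continuous_intros contM)
        then have "\<psi> ` closure P \<subseteq> closure (\<psi> ` P)"
          by (intro image_closure_subset) (auto intro: continuous_on_subset closure_subset[THEN subsetD])
        moreover have "\<psi> ` P \<subseteq> {g\<in>P. L g = h (M f)}"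
          using v(2) shift[OF _ v(1)] Lh by (auto simp: \<psi>_def)
        ultimately have "\<psi> f \<in> closure {g\<in>P. L g = h (M f)}"
          using f closure_mono by blast
        then show ?thesis by (simp add: \<psi>_def)
      qed
      then show ?thesis using M by blast
    qed
  next
    case False
    have small: "\<exists>v\<in>?K. L v = 1 \<and> norm v < e" if "e > 0" for e :: real
      using unbounded_imp_small_with_value_1[OF K L False that] .
    have "f \<in> closure {g\<in>P. L g = 0}" if f: "f \<in> closure P" for f
      unfolding closure_approachable
    proof (intro allI impI)
      fix e :: real assume e: "e > 0"
      obtain g where g: "g \<in> P" "dist g f < e / 2"
        using f e unfolding closure_approachable by (meson half_gt_zero)
      \<comment> \<open>The size of \<open>v\<close> makes the shift by \<open>- L g\<close> times
        \<open>v\<close> cost at most \<open>e / 2\<close>; the \<open>+ 1\<close> covers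
        \<open>L g = 0\<close>.\<close>
      obtain v where v: "v \<in> ?K" "L v = 1" "norm v < e / 2 / (\<bar>L g\<bar> + 1)"
        using small[of "e / 2 / (\<bar>L g\<bar> + 1)"] e by auto
      have "\<bar>L g\<bar> * norm v \<le> (\<bar>L g\<bar> + 1) * norm v" by (intro mult_right_mono) auto
      also have "\<dots> \<le> e / 2" using v(3) by (simp add: field_simps)
      finally have "dist (g + (- L g) *\<^sub>R v) g \<le> e / 2" by (simp add: dist_norm)
      then have "dist (g + (- L g) *\<^sub>R v) f < e"
        using g(2) dist_triangle[of "g + (- L g) *\<^sub>R v" f g] by linarith
      moreover have "L (g + (- L g) *\<^sub>R v) = 0"
        by (simp only: linear_add[OF L] linear_scale[OF L] v(2)) simp
      ultimately show "\<exists>y\<in>{g\<in>P. L g = 0}. dist y f < e"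
        using shift[OF g(1) v(1), of "- L g"] by blast
    qed
    then show ?thesis
      by (intro exI[of _ "\<lambda>_. 0"]) (auto intro: bounded_linear_zero)
  qed
qed

section \<open>Simulating adaptive information\<close>

lemma length_info [simp]: "length (info L n f) = n"
  by (induction n) auto

lemma info_cong:
  assumes "\<And>ys. length ys < n \<Longrightarrow> L ys = M ys"
  shows "info L n f = info M n f"
proof -
  have "k \<le> n \<Longrightarrow> info L k f = info M k f" for k
    by (induction k) (auto simp: assms)
  then show ?thesis by simp
qed

text \<open>Fixing the values \<open>ys\<close> also fixes which functionals are used, so on one
  level set adaptive information behaves like nonadaptive information. Nonempty level sets are thus
  translates of a common kernel.\<close>

lemma info_level_set:
  fixes L :: "real list \<Rightarrow> 'a::real_normed_vector \<Rightarrow> real"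
  assumes "\<And>ys. length ys < n \<Longrightarrow> linear (L ys)" and "info L n p = ys"
  shows "info L n q = ys \<longleftrightarrow> (\<forall>T\<in>(\<lambda>i. L (take i ys)) ` {..<n}. T (q - p) = 0)"
  using assms
proof (induction n arbitrary: ys)
  case 0
  then show ?case by simp
next
  case (Suc n)
  define zs where "zs = info L n p"
  have ys: "ys = zs @ [L zs p]" using Suc.prems(2) by (simp add: zs_def)
  have len: "length zs = n" by (simp add: zs_def)
  have lin: "linear (L zs)" using Suc.prems(1) len by simp
  have "info L (Suc n) q = ys \<longleftrightarrow> info L n q = zs \<and> L zs (q - p) = 0"
    by (auto simp: ys linear_diff[OF lin])
  also have "\<dots> \<longleftrightarrow> (\<forall>T\<in>(\<lambda>i. L (take i zs)) ` {..<n}. T (q - p) = 0) \<and> L zs (q - p) = 0"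
    using Suc.IH[of zs] Suc.prems(1) by (simp add: zs_def)
  also have "\<dots> \<longleftrightarrow> (\<forall>T\<in>(\<lambda>i. L (take i ys)) ` {..<Suc n}. T (q - p) = 0)"
    using len by (auto simp: ys lessThan_Suc)
  finally show ?case .
qed

text \<open>The map \<open>t\<close> translates measured values into simulated values of
  \<open>L\<close>. The element \<open>f\<close> need not have these values itself, but it is a
  limit of elements that do.\<close>

lemma simulate_info:
  fixes L :: "real list \<Rightarrow> 'a::real_normed_vector \<Rightarrow> real"
  assumes "\<And>ys. length ys < n \<Longrightarrow> linear (L ys)"
  shows "\<exists>M t. (\<forall>zs. bounded_linear (M zs)) \<and> (\<forall>f. f \<in> closure {g. info L n g = t (info M n f)})"
  using assms
proof (induction n)
  case 0
  show ?case
    by (rule exI[of _ "\<lambda>_ _. 0"], rule exI[of _ "\<lambda>_. []"]) (auto intro: bounded_linear_zero)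
next
  case (Suc n)
  then obtain M t where M: "\<And>zs. bounded_linear (M zs)"
    and t: "\<And>f. f \<in> closure {g. info L n g = t (info M n f)}"
    by (metis less_SucI)
  define simulates where "simulates ys N h \<longleftrightarrow> bounded_linear N \<and>
      (\<forall>f\<in>closure {g. info L n g = ys}. f \<in> closure {g\<in>{g. info L n g = ys}. L ys g = h (N f)})"
    for ys and N :: "'a \<Rightarrow> real" and h
  have "\<exists>N h. simulates ys N h" if "length ys = n" for ys
    unfolding simulates_def
    by (rule simulate_functional_on_level_set[where F = "(\<lambda>i. L (take i ys)) ` {..<n}"])
       (use Suc.prems that info_level_set[of n L] in auto)
  then obtain N h where "\<And>ys. length ys = n \<Longrightarrow> simulates ys (N ys) (h ys)"
    by metis
  then have N: "\<And>ys. length ys = n \<Longrightarrow> bounded_linear (N ys)"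
    and h: "\<And>ys f. length ys = n \<Longrightarrow> f \<in> closure {g. info L n g = ys} \<Longrightarrow>
          f \<in> closure {g\<in>{g. info L n g = ys}. L ys g = h ys (N ys f)}"
    by (auto simp: simulates_def)
  \<comment> \<open>A set with a point in its closure is nonempty, so the translated list is the
    information of some element.\<close>
  have len: "length (t (info M n f)) = n" for f
    using t[of f] by (metis (mono_tags, lifting) Collect_empty_eq closure_empty empty_iff length_info)
  \<comment> \<open>On shorter lists \<open>M'\<close> is \<open>M\<close>, which preserves the
    first \<open>n\<close> values. The test on \<open>t zs\<close> guards against lists that are not
    information of any element, where \<open>N\<close> need not be bounded.\<close>
  define M' where "M' zs = (if length zs = n \<and> length (t zs) = n then N (t zs) else M zs)" for zs
  define t' where "t' zs = t (butlast zs) @ [h (t (butlast zs)) (last zs)]" for zs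
  have infoM': "info M' (Suc n) f = info M n f @ [N (t (info M n f)) f]" for f
    using info_cong[of n M' M f] by (simp add: M'_def len)
  have "f \<in> closure {g. info L (Suc n) g = t' (info M' (Suc n) f)}" for f
  proof -
    have "{g\<in>{g. info L n g = t (info M n f)}. L (t (info M n f)) g
          = h (t (info M n f)) (N (t (info M n f)) f)} \<subseteq> {g. info L (Suc n) g = t' (info M' (Suc n) f)}"
      unfolding infoM' by (auto simp: t'_def)
    then show ?thesis using h[OF len t] closure_mono by blast
  qed
  moreover have "bounded_linear (M' zs)" for zs by (simp add: M'_def M N)
  ultimately show ?case by blast
qed

section \<open>Transfer of the error bound\<close>

lemma wor_error_simulation:
  fixes S :: "'a::real_normed_vector \<Rightarrow> 'b::real_normed_vector"
  assumes S: "continuous_on UNIV S" and A: "A \<in> algorithms Lambda_all_tilde n"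
  shows "\<exists>B\<in>algorithms Lambda_all n. wor_error S B \<le> wor_error S A"
proof -
  obtain L \<phi> where L: "\<And>ys. length ys < n \<Longrightarrow> linear (L ys)" and A: "\<And>f. A f = \<phi> (info L n f)"
    using A by (auto simp: algorithms_def Lambda_all_tilde_def)
  obtain M t where M: "\<And>zs. bounded_linear (M zs)"
    and t: "\<And>f. f \<in> closure {g. info L n g = t (info M n f)}"
    using simulate_info[of n L] L by blast
  define B where "B f = \<phi> (t (info M n f))" for f
  have "B \<in> algorithms Lambda_all n"
    unfolding algorithms_def Lambda_all_def using M
    by (auto simp: B_def intro!: exI[of _ M] exI[of _ "\<phi> \<circ> t"] linear_continuous_on
        bounded_linear.linear)
  moreover have "ennreal (norm (S f - B f)) \<le> wor_error S A" if f: "norm f < 1" for f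
  proof -
    let ?Q = "{g. info L n g = t (info M n f)}"
    let ?E = "{g. ennreal (norm (S g - B f)) \<le> wor_error S A}"
    \<comment> \<open>Openness of the unit ball lets \<open>f\<close> be approached by elements of
      \<open>?Q\<close> that are themselves in the ball.\<close>
    have "f \<in> closure (ball 0 1 \<inter> ?Q)"
      using open_Int_closure_subset[of "ball 0 1" ?Q] t[of f] f by auto
    \<comment> \<open>On \<open>?Q\<close> the algorithm \<open>A\<close> takes the constant value
      \<open>B f\<close>; since \<open>S\<close> is continuous, the bound then survives the
      limit.\<close>
    moreover have "ball 0 1 \<inter> ?Q \<subseteq> ?E"
      unfolding wor_error_def by (auto simp: B_def A intro!: SUP_upper2)
    moreover have "closed ?E"
      by (intro closed_Collect_le continuous_on_ennreal continuous_intros S)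
    ultimately show ?thesis using closure_minimal by blast
  qed
  then have "wor_error S B \<le> wor_error S A"
    unfolding wor_error_def[of S B] by (auto intro: SUP_least)
  ultimately show ?thesis by blast
qed

theorem theorem1:
  fixes S :: "'a::real_normed_vector \<Rightarrow> 'b::real_normed_vector"
    and n :: nat
  assumes "continuous_on UNIV S"
  shows "e_all_wor n S = e_all_wor_tilde n S"
  unfolding e_all_wor_def e_all_wor_tilde_def minimal_wor_error_def
proof (rule antisym)
  show "(INF A\<in>algorithms Lambda_all n. wor_error S A)
      \<le> (INF A\<in>algorithms Lambda_all_tilde n. wor_error S A)"
    using wor_error_simulation[OF assms] by (intro INF_mono) blast
  have "algorithms Lambda_all n \<subseteq> algorithms Lambda_all_tilde n"
    by (auto simp: algorithms_def Lambda_all_def Lambda_all_tilde_def)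
  then show "(INF A\<in>algorithms Lambda_all_tilde n. wor_error S A)
      \<le> (INF A\<in>algorithms Lambda_all n. wor_error S A)"
    by (intro INF_superset_mono) auto
qed

end
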